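(* Let $n,p,q$ be positive integers with $n>q$ and let $\pi_{\mathrm{CBP}}$ be the (unnormalized) stationary distribution of the colored Boolean process on $\Omega^{p,q}_n$. (1) For any binary words $w,w'\in S_n(1^q0^{n-q})$, $\pi_{\mathrm{CBP}}(w,1^q0^{n-q})=\pi_{\mathrm{CBP}}(w',1^q0^{n-q})$. (2) For every $(w,\lambda)\in\Omega^{p,q}_n$ with $\lambda=\langle 1^{m_1}\cdots p^{m_p}\rangle$, $$\pi_{\mathrm{CBP}}(w,\lambda)=u^{|\lambda|-q}\binom{q}{m_1,\dots,m_p}\pi_{\mathrm{CBP}}(w,1^q0^{n-q}).$$
   Context: Partitions are written as $n$-tuples $(\lambda_1\ge\cdots\ge\lambda_n\ge0)$; $|\lambda|=\sum\lambda_i$, $m_i$ is the number of parts equal to $i$, $\ell(\lambda)$ the number of positive parts, $\lambda=\langle1^{m_1}2^{m_2}\cdots\rangle$; $1^q0^{n-q}$ is the partition with $q$ parts equal to $1$ and $n-q$ parts equal to $0$. Binary words are the rearrangements of $(1^q0^{n-q})$. Colored Boolean process (parameters $t,u\in[0,1]$): the Markov chain on $\Omega^{p,q}_n=\{(w,\lambda): w \text{ a binary word},\ \lambda_1\le p,\ \ell(\lambda)=q\}$ with transitions: from $(w,\lambda)$ to $(w,\lambda')$ with probability $\frac{m_i u}{3n}$ if $\lambda$ has $m_i\ge1$ parts equal to $i$ and $\lambda'$ is obtained by changing one part equal to $i$ into $i+1$; with probability $\frac{m_i}{3n}$ if $\lambda'$ is obtained by changing one part equal to $i$ into $i-1$ (in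 both cases $\lambda'$ must satisfy $\lambda'_1\le p$, $\ell(\lambda')=q$); from $(w,\lambda)$ to $(w',\lambda)$ with probability $\frac{1}{3n}$ if $w'$ is obtained from $w$ by replacing one occurrence of $01$ at cyclically consecutive positions (position $n$ followed by position $1$) by $10$, and with probability $\frac{t}{3n}$ if $w'$ is obtained by replacing one cyclically consecutive $10$ by $01$; all other off-diagonal probabilities are $0$ and diagonal entries make rows sum to $1$. *)

theory Defs
  imports Complex_Main "HOL-Combinatorics.Multiset_Permutations"
begin

text \<open>Partitions are weakly decreasing \<open>n\<close>-tuples of natural numbers, represented as lists of
  length \<open>n\<close> with trailing zeros kept.\<close>

definition is_partition :: "nat \<Rightarrow> nat list \<Rightarrow> bool" where
  "is_partition n \<mu> \<longleftrightarrow> length \<mu> = n \<and> sorted_wrt (\<ge>) \<mu>"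

definition num_parts :: "nat list \<Rightarrow> nat" where
  "num_parts \<mu> = length (filter (\<lambda>x. 0 < x) \<mu>)"

definition column :: "nat \<Rightarrow> nat \<Rightarrow> nat list" where
  "column n q = replicate q 1 @ replicate (n - q) 0"

definition binary_words :: "nat \<Rightarrow> nat \<Rightarrow> nat list set" where
  "binary_words n q = permutations_of_multiset (mset (column n q))"

definition cbp_states :: "nat \<Rightarrow> nat \<Rightarrow> nat \<Rightarrow> (nat list \<times> nat list) set" where
  "cbp_states n p q =
     {(w, \<mu>). w \<in> binary_words n q \<and> is_partition n \<mu> \<and> hd \<mu> \<le> p \<and> num_parts \<mu> = q}"

definition changes_part :: "nat \<Rightarrow> nat \<Rightarrow> nat list \<Rightarrow> nat list \<Rightarrow> bool" where
  "changes_part i j \<mu> \<mu>' \<longleftrightarrow> i \<in> set \<mu> \<and> mset \<mu>' = mset \<mu> - {#i#} + {#j#}"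

text \<open>Both \<open>\<mu>\<close> and \<open>\<mu>'\<close> are meant to be partitions, so for \<open>\<mu> \<noteq> \<mu>'\<close> at most one summand below is
  nonzero. The constraints on \<open>\<mu>'\<close> (largest part, number of positive parts) are imposed by
  restricting the chain to \<open>cbp_states\<close>; in particular a part \<open>0\<close> is never changed.\<close>

definition part_rate :: "nat \<Rightarrow> real \<Rightarrow> nat list \<Rightarrow> nat list \<Rightarrow> real" where
  "part_rate n u \<mu> \<mu>' =
     (\<Sum>i\<in>set \<mu>. if changes_part i (i + 1) \<mu> \<mu>'
                 then real (count_list \<mu> i) * u / (3 * real n) else 0) +
     (\<Sum>i\<in>set \<mu>. if 1 \<le> i \<and> changes_part i (i - 1) \<mu> \<mu>'
                 then real (count_list \<mu> i) / (3 * real n) else 0)"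

text \<open>\<open>replaces_at n k a b w w'\<close>: the word \<open>w\<close> reads \<open>ab\<close> at the cyclically consecutive (0-based)
  positions \<open>k\<close>, \<open>k + 1\<close>, and \<open>w'\<close> arises from \<open>w\<close> by turning this occurrence into \<open>ba\<close>.\<close>

definition replaces_at :: "nat \<Rightarrow> nat \<Rightarrow> nat \<Rightarrow> nat \<Rightarrow> nat list \<Rightarrow> nat list \<Rightarrow> bool" where
  "replaces_at n k a b w w' \<longleftrightarrow>
     w ! k = a \<and> w ! (Suc k mod n) = b \<and> w' = w[k := b, Suc k mod n := a]"

text \<open>Probabilities are added over all occurrences. For \<open>n \<ge> 3\<close> at most one occurrence contributes
  to a given pair of words; for \<open>n = 2\<close> the two words \<open>01\<close> and \<open>10\<close> are linked by both kinds of moves.\<close>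

definition word_rate :: "nat \<Rightarrow> real \<Rightarrow> nat list \<Rightarrow> nat list \<Rightarrow> real" where
  "word_rate n t w w' =
     (\<Sum>k<n. if replaces_at n k 0 1 w w' then 1 / (3 * real n) else 0) +
     (\<Sum>k<n. if replaces_at n k 1 0 w w' then t / (3 * real n) else 0)"

definition cbp_rate :: "nat \<Rightarrow> real \<Rightarrow> real \<Rightarrow> nat list \<times> nat list \<Rightarrow> nat list \<times> nat list \<Rightarrow> real" where
  "cbp_rate n t u x y =
     (if fst x = fst y then part_rate n u (snd x) (snd y)
      else if snd x = snd y then word_rate n t (fst x) (fst y)
      else 0)"

definition cbp_prob ::
  "nat \<Rightarrow> nat \<Rightarrow> nat \<Rightarrow> real \<Rightarrow> real \<Rightarrow> nat list \<times> nat list \<Rightarrow> nat list \<times> nat list \<Rightarrow> real" where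
  "cbp_prob n p q t u x y =
     (if x = y then 1 - (\<Sum>z\<in>cbp_states n p q - {x}. cbp_rate n t u x z) else cbp_rate n t u x y)"

text \<open>Unnormalized stationary distribution of a finite chain: nonnegative, not identically zero, and
  a left fixed vector of the transition matrix.\<close>

definition stationary :: "'s set \<Rightarrow> ('s \<Rightarrow> 's \<Rightarrow> real) \<Rightarrow> ('s \<Rightarrow> real) \<Rightarrow> bool" where
  "stationary S P \<pi> \<longleftrightarrow>
     (\<forall>x\<in>S. 0 \<le> \<pi> x) \<and> (\<exists>x\<in>S. \<pi> x \<noteq> 0) \<and> (\<forall>y\<in>S. (\<Sum>x\<in>S. \<pi> x * P x y) = \<pi> y)"

definition multinomial :: "nat \<Rightarrow> nat list \<Rightarrow> real" where
  "multinomial q ms = fact q / (\<Prod>m\<leftarrow>ms. fact m)"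

lemma finite_cbp_states: "finite (cbp_states n p q)"
proof (rule finite_subset)
  have "x \<le> hd l" if "x \<in> set l" "sorted_wrt (\<ge>) l" for x :: nat and l
    using that by (cases l) auto
  then show "cbp_states n p q \<subseteq> binary_words n q \<times> {l. set l \<subseteq> {..p} \<and> length l = n}"
    by (fastforce simp: cbp_states_def is_partition_def)
  show "finite (binary_words n q \<times> {l. set l \<subseteq> {..p} \<and> length l = n})"
    by (simp add: binary_words_def finite_lists_length_eq)
qed

end

theory Submission
  imports Defs
begin

text \<open>Write \<open>f (w, \<mu>)\<close> for the claimed weight \<open>u^(|\<mu>| - q)\<close> times the multinomial coefficient.
  The two coordinates of the chain move independently. The partition moves are in detailed balance
  with \<open>f\<close>, and the uniform measure is balanced for the word moves because a cyclic binary word has as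
  many factors \<open>01\<close> as factors \<open>10\<close>. So \<open>f\<close> is stationary, and so is \<open>d = \<pi> - c f\<close>,
  where \<open>c\<close> is chosen to make \<open>d\<close> vanish at the state \<open>r\<close> with both coordinates equal to
  \<open>1^q 0^(n-q)\<close>. The absolute value of a stationary signed vector is stationary, and a nonnegative
  stationary vector vanishing at a state vanishes at all states leading to it. Lowering parts and
  sorting the word by moves \<open>01 \<rightarrow> 10\<close> leads from every state to \<open>r\<close>, even for \<open>t = 0\<close> or \<open>u = 0\<close>,
  so \<open>d = 0\<close>.\<close>

section \<open>Balanced signed vectors\<close>

text \<open>Inflow equals outflow at every state. No sign is imposed on \<open>d\<close>, so
  differences stay balanced, and diagonal entries of \<open>R\<close> contribute equally to both
  sides.\<close>

definition balanced :: "'s set \<Rightarrow> ('s \<Rightarrow> 's \<Rightarrow> real) \<Rightarrow> ('s \<Rightarrow> real) \<Rightarrow> bool" where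
  "balanced S R d \<longleftrightarrow> (\<forall>y\<in>S. (\<Sum>x\<in>S. d x * R x y) = d y * (\<Sum>z\<in>S. R y z))"

lemma balanced_diff_scale:
  assumes "balanced S R d" and "balanced S R e"
  shows "balanced S R (\<lambda>x. d x - c * e x)"
  using assms
  by (simp add: balanced_def left_diff_distrib sum_subtractf mult.assoc flip: sum_distrib_left)

text \<open>The triangle inequality makes every gap between inflow and outflow of the absolute
  values nonnegative. Total inflow and total outflow agree, so each gap is zero.\<close>

lemma balanced_abs:
  assumes "finite S" and nonneg: "\<And>x y. x \<in> S \<Longrightarrow> y \<in> S \<Longrightarrow> 0 \<le> R x y"
    and "balanced S R d"
  shows "balanced S R (\<lambda>x. \<bar>d x\<bar>)"
proof -
  let ?gap = "\<lambda>y. (\<Sum>x\<in>S. \<bar>d x\<bar> * R x y) - \<bar>d y\<bar> * (\<Sum>z\<in>S. R y z)"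
  have "0 \<le> ?gap y" if "y \<in> S" for y
  proof -
    have "\<bar>d y\<bar> * (\<Sum>z\<in>S. R y z) = \<bar>d y * (\<Sum>z\<in>S. R y z)\<bar>"
      using that by (simp add: abs_mult nonneg sum_nonneg)
    also have "\<dots> = \<bar>\<Sum>x\<in>S. d x * R x y\<bar>"
      using assms(3) that by (simp add: balanced_def)
    also have "\<dots> \<le> (\<Sum>x\<in>S. \<bar>d x * R x y\<bar>)"
      by (rule sum_abs)
    also have "\<dots> = (\<Sum>x\<in>S. \<bar>d x\<bar> * R x y)"
      using that by (intro sum.cong) (auto simp: abs_mult nonneg)
    finally show ?thesis by simp
  qed
  moreover have "(\<Sum>y\<in>S. ?gap y) = 0"
    by (simp add: sum_subtractf sum_distrib_left) (rule sum.swap)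
  ultimately have "\<forall>y\<in>S. ?gap y = 0"
    using sum_nonneg_eq_0_iff[OF assms(1), of ?gap] by simp
  then show ?thesis by (simp add: balanced_def)
qed

text \<open>Zeros spread backwards along positive rates: if \<open>d y = 0\<close>, the inflow of
  absolute values into \<open>y\<close> is a vanishing sum of nonnegative terms, which forces
  \<open>d x = 0\<close> at each predecessor \<open>x\<close>.\<close>

lemma balanced_eq_0:
  assumes fin: "finite S" and nonneg: "\<And>x y. x \<in> S \<Longrightarrow> y \<in> S \<Longrightarrow> 0 \<le> R x y"
    and bal: "balanced S R d" and "d r = 0"
    and reach: "(x, r) \<in> {(x, y). x \<in> S \<and> y \<in> S \<and> 0 < R x y}\<^sup>*"
  shows "d x = 0"
  using reach
proof (induction rule: converse_rtrancl_induct)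
  case base
  show ?case by fact
next
  case (step x y)
  then have *: "x \<in> S" "y \<in> S" "0 < R x y" "d y = 0" by auto
  have "(\<Sum>x\<in>S. \<bar>d x\<bar> * R x y) = 0"
    using balanced_abs[OF fin nonneg bal] * by (simp add: balanced_def)
  then have "\<bar>d x\<bar> * R x y = 0"
    using fin * nonneg by (subst (asm) sum_nonneg_eq_0_iff) auto
  then show ?case using * by simp
qed

section \<open>Partitions\<close>

definition partitions :: "nat \<Rightarrow> nat \<Rightarrow> nat \<Rightarrow> nat list set" where
  "partitions n p q = {\<mu>. is_partition n \<mu> \<and> hd \<mu> \<le> p \<and> num_parts \<mu> = q}"

lemma cbp_states_eq: "cbp_states n p q = binary_words n q \<times> partitions n p q"
  by (auto simp: cbp_states_def partitions_def)

lemma finite_binary_words: "finite (binary_words n q)"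
  by (simp add: binary_words_def)

lemma sorted_desc_le_hd:
  assumes "sorted_wrt (\<ge>) l" and "x \<in> set l"
  shows "x \<le> hd (l :: nat list)"
  using assms by (cases l) auto

lemma sorted_desc_unique:
  fixes xs ys :: "nat list"
  assumes "sorted_wrt (\<ge>) xs" "sorted_wrt (\<ge>) ys" "mset xs = mset ys"
  shows "xs = ys"
proof -
  have "rev xs = rev ys"
    using assms by (metis mset_rev properties_for_sort sorted_wrt_rev)
  then show ?thesis by simp
qed

lemma sorted_column: "sorted_wrt (\<ge>) (column n q)"
proof -
  have "sorted_wrt (\<ge>) (replicate k x)" for k and x :: nat
    by (induction k) auto
  then show ?thesis by (auto simp: column_def sorted_wrt_append)
qed

lemma mset_le_1:
  assumes "set \<mu> \<subseteq> {0, 1}"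
  shows "mset \<mu> = mset (column (length \<mu>) (num_parts \<mu>))"
proof -
  \<comment> \<open>The bound on \<open>num_parts \<mu>\<close> is carried through the induction
    because the number of zeros is a truncated difference.\<close>
  have "mset \<mu> = replicate_mset (num_parts \<mu>) 1 + replicate_mset (length \<mu> - num_parts \<mu>) 0
    \<and> num_parts \<mu> \<le> length \<mu>"
    using assms
  proof (induction \<mu>)
    case (Cons x \<mu>)
    then show ?case
      by (cases "x = 0") (simp_all add: num_parts_def Suc_diff_le le_SucI)
  qed (simp add: num_parts_def)
  then show ?thesis by (simp add: column_def)
qed

lemma num_parts_mset: "num_parts \<mu> = size (filter_mset (\<lambda>x. 0 < x) (mset \<mu>))"
  by (simp add: num_parts_def flip: mset_filter)

lemma num_parts_le_sum_list: "num_parts \<mu> \<le> sum_list \<mu>"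
  by (induction \<mu>) (auto simp: num_parts_def)

lemma column_in_partitions:
  assumes "0 < p" "0 < q" "q < n"
  shows "column n q \<in> partitions n p q"
  using assms sorted_column[of n q]
  by (auto simp: partitions_def is_partition_def num_parts_def column_def hd_append filter_replicate)

lemma partition_le:
  assumes "\<mu> \<in> partitions n p q" "x \<in> set \<mu>"
  shows "x \<le> p"
  using sorted_desc_le_hd[of \<mu> x] assms by (auto simp: partitions_def is_partition_def)

section \<open>Changing a single part\<close>

lemma changes_part_iff:
  "changes_part i j \<mu> \<mu>' \<longleftrightarrow> (\<exists>M. mset \<mu> = add_mset i M \<and> mset \<mu>' = add_mset j M)"
proof
  assume *: "changes_part i j \<mu> \<mu>'"
  then have "i \<in># mset \<mu>" by (simp add: changes_part_def)
  then obtain M where "mset \<mu> = add_mset i M" using multi_member_split by metis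
  moreover from this have "mset \<mu>' = add_mset j M" using * by (simp add: changes_part_def)
  ultimately show "\<exists>M. mset \<mu> = add_mset i M \<and> mset \<mu>' = add_mset j M" by blast
next
  assume "\<exists>M. mset \<mu> = add_mset i M \<and> mset \<mu>' = add_mset j M"
  then obtain M where M: "mset \<mu> = add_mset i M" "mset \<mu>' = add_mset j M" by blast
  then have "i \<in> set \<mu>" by (metis set_mset_mset union_single_eq_member)
  then show "changes_part i j \<mu> \<mu>'" using M by (simp add: changes_part_def)
qed

lemma changes_part_sym: "changes_part i j \<mu> \<mu>' \<Longrightarrow> changes_part j i \<mu>' \<mu>"
  by (auto simp: changes_part_iff)

text \<open>Raising a part \<open>i\<close> lowers no multiplicity except that of \<open>i\<close>,
  while the second assumption lowers that of \<open>k\<close>.\<close>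

lemma changes_part_unique:
  assumes "changes_part i (Suc i) \<mu> \<mu>'" "changes_part k (Suc k) \<mu> \<mu>'"
  shows "k = i"
proof (rule ccontr)
  assume "k \<noteq> i"
  then have "count (mset \<mu>') k \<ge> count (mset \<mu>) k"
    using assms(1) by (auto simp: changes_part_def)
  moreover have "count (mset \<mu>') k < count (mset \<mu>) k"
    using assms(2) by (auto simp: changes_part_def count_mset_gt_0)
  ultimately show False by simp
qed

text \<open>Raising a part 0 would create a new positive part.\<close>

lemma changes_part_pos:
  assumes "changes_part i (Suc i) \<mu> \<mu>'" "num_parts \<mu>' = num_parts \<mu>"
  shows "0 < i"
proof (rule ccontr)
  assume "\<not> 0 < i"
  then have "num_parts \<mu>' = Suc (num_parts \<mu>)"
    using assms(1) by (simp add: num_parts_mset changes_part_def)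
  then show False using assms(2) by simp
qed

text \<open>The two summands of \<open>part_rate\<close> get names of their own because detailed
  balance pairs the up rate of a move with the down rate of its reversal.\<close>

definition up_rate :: "nat \<Rightarrow> real \<Rightarrow> nat list \<Rightarrow> nat list \<Rightarrow> real" where
  "up_rate n u \<mu> \<mu>' = (\<Sum>i\<in>set \<mu>. if changes_part i (i + 1) \<mu> \<mu>'
                 then real (count_list \<mu> i) * u / (3 * real n) else 0)"

definition down_rate :: "nat \<Rightarrow> nat list \<Rightarrow> nat list \<Rightarrow> real" where
  "down_rate n \<mu> \<mu>' = (\<Sum>i\<in>set \<mu>. if 1 \<le> i \<and> changes_part i (i - 1) \<mu> \<mu>'
                 then real (count_list \<mu> i) / (3 * real n) else 0)"

lemma part_rate_eq: "part_rate n u \<mu> \<mu>' = up_rate n u \<mu> \<mu>' + down_rate n \<mu> \<mu>'"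
  by (simp add: part_rate_def up_rate_def down_rate_def)

lemma up_rate_change:
  assumes "changes_part i (Suc i) \<mu> \<mu>'"
  shows "up_rate n u \<mu> \<mu>' = real (count_list \<mu> i) * u / (3 * real n)"
proof -
  have "changes_part k (k + 1) \<mu> \<mu>' \<longleftrightarrow> k = i" for k
    using assms changes_part_unique[OF assms, of k] by auto
  moreover have "i \<in> set \<mu>" using assms by (simp add: changes_part_def)
  ultimately show ?thesis by (simp add: up_rate_def)
qed

lemma down_rate_change:
  assumes "changes_part i (Suc i) \<mu> \<mu>'"
  shows "down_rate n \<mu>' \<mu> = real (count_list \<mu>' (Suc i)) / (3 * real n)"
proof -
  have s: "changes_part (Suc i) i \<mu>' \<mu>"
    using assms by (rule changes_part_sym)
  have "1 \<le> k \<and> changes_part k (k - 1) \<mu>' \<mu> \<longleftrightarrow> k = Suc i" for k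
    using changes_part_unique[OF assms, of "k - 1"] changes_part_sym[of k "k - 1" \<mu>' \<mu>] s
    by (cases k) auto
  moreover have "Suc i \<in> set \<mu>'" using s by (simp add: changes_part_def)
  ultimately show ?thesis by (simp add: down_rate_def)
qed

section \<open>The weight and detailed balance of the partition moves\<close>

definition weight :: "nat \<Rightarrow> nat \<Rightarrow> real \<Rightarrow> nat list \<Rightarrow> real" where
  "weight p q u \<mu> = u ^ (sum_list \<mu> - q) * multinomial q (map (count_list \<mu>) [1..<p + 1])"

lemma weight_eq:
  "weight p q u \<mu> = u ^ (sum_list \<mu> - q) * fact q / (\<Prod>i\<in>{1..p}. fact (count_list \<mu> i))"
proof -
  have "(\<Prod>i\<in>set [1..<p + 1]. fact (count_list \<mu> i)) = (\<Prod>i\<leftarrow>[1..<p + 1]. fact (count_list \<mu> i) :: real)"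
    by (rule prod.distinct_set_conv_list) simp
  moreover have "set [1..<p + 1] = {1..p}" by auto
  ultimately show ?thesis
    by (simp add: weight_def multinomial_def o_def)
qed

lemma weight_column:
  assumes "0 < p"
  shows "weight p q u (column n q) = 1"
proof -
  have "(\<Prod>i\<in>{1..p}. fact (count_list (column n q) i)) = (\<Prod>i\<in>{1..p}. if i = 1 then fact q else 1 :: real)"
    by (intro prod.cong) (auto simp: column_def simp flip: count_mset)
  also have "\<dots> = fact q" using assms by simp
  finally show ?thesis
    by (simp add: weight_eq column_def sum_list_replicate)
qed

text \<open>Raising one part \<open>i\<close> multiplies the weight by \<open>u\<close> and changes
  only two factorials in the denominator, those of the multiplicities of \<open>i\<close> and
  \<open>Suc i\<close>. The bounds on \<open>i\<close> place both in the product.\<close>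

lemma weight_change:
  assumes "changes_part i (Suc i) \<mu> \<mu>'" "0 < i" "Suc i \<le> p" "q \<le> sum_list \<mu>"
  shows "weight p q u \<mu> * (real (count_list \<mu> i) * u) =
    weight p q u \<mu>' * real (count_list \<mu>' (Suc i))"
proof -
  let ?P = "\<lambda>\<mu>. \<Prod>k\<in>{1..p}. fact (count_list \<mu> k) :: real"
  let ?Q = "\<lambda>\<mu>. \<Prod>k\<in>{1..p} - {i} - {Suc i}. fact (count_list \<mu> k) :: real"
  obtain M where m: "mset \<mu> = add_mset i M" "mset \<mu>' = add_mset (Suc i) M"
    using assms(1) by (auto simp: changes_part_iff)
  have P: "?P \<mu> = fact (count_list \<mu> i) * (fact (count_list \<mu> (Suc i)) * ?Q \<mu>)" for \<mu>
    using assms(2,3)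
    by (subst prod.remove[of _ i], simp, simp, subst prod.remove[of _ "Suc i"], simp_all)
  have Q: "?Q \<mu>' = ?Q \<mu>"
    by (intro prod.cong) (auto simp: m simp flip: count_mset)
  have c1: "count_list \<mu> i = Suc (count_list \<mu>' i)"
    using m by (simp flip: count_mset)
  have c2: "count_list \<mu>' (Suc i) = Suc (count_list \<mu> (Suc i))"
    using m by (simp flip: count_mset)
  have "sum_list \<mu>' = Suc (sum_list \<mu>)"
    by (simp add: m flip: sum_mset_sum_list)
  then have "sum_list \<mu>' - q = Suc (sum_list \<mu> - q)"
    using assms(4) by simp
  then have e: "u ^ (sum_list \<mu>' - q) = u * u ^ (sum_list \<mu> - q)" by simp
  \<comment> \<open>Here \<open>x\<close> and \<open>y\<close> stand for
    \<open>count_list \<mu> i\<close> and \<open>count_list \<mu>' (Suc i)\<close>, \<open>A\<close>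
    and \<open>B\<close> for the factorials of their predecessors, \<open>C\<close> for the common
    product \<open>?Q \<mu>\<close>.\<close>
  have cancel: "U * F / (x * A * (B * C)) * (x * u) = u * U * F / (A * (y * B * C)) * y"
    if "x \<noteq> 0" "y \<noteq> 0" for x y A B C F U :: real
    using that by (simp add: mult_ac)
  show ?thesis
    unfolding weight_eq P Q c1 c2 e fact_Suc by (rule cancel) simp_all
qed

text \<open>If \<open>\<mu>'\<close> arises by raising a part, membership in
  \<open>partitions\<close> supplies the side conditions of \<open>weight_change\<close>. Otherwise
  both rates vanish.\<close>

lemma up_down_balance:
  assumes "\<mu> \<in> partitions n p q" "\<mu>' \<in> partitions n p q"
  shows "weight p q u \<mu> * up_rate n u \<mu> \<mu>' = weight p q u \<mu>' * down_rate n \<mu>' \<mu>"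
proof (cases "\<exists>i. changes_part i (Suc i) \<mu> \<mu>'")
  case True
  then obtain i where i: "changes_part i (Suc i) \<mu> \<mu>'" by blast
  have "0 < i" using changes_part_pos[OF i] assms by (simp add: partitions_def)
  moreover have "Suc i \<le> p"
    using partition_le[OF assms(2)] changes_part_sym[OF i] by (simp add: changes_part_def)
  moreover have "q \<le> sum_list \<mu>"
    using num_parts_le_sum_list[of \<mu>] assms(1) by (simp add: partitions_def)
  ultimately have "weight p q u \<mu> * (real (count_list \<mu> i) * u) / (3 * real n) =
      weight p q u \<mu>' * real (count_list \<mu>' (Suc i)) / (3 * real n)"
    using weight_change[OF i] by simp
  then show ?thesis
    by (simp add: up_rate_change[OF i] down_rate_change[OF i])
next
  case False
  then have "up_rate n u \<mu> \<mu>' = 0"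
    by (simp add: up_rate_def)
  moreover have "\<not> (1 \<le> k \<and> changes_part k (k - 1) \<mu>' \<mu>)" for k
    using False changes_part_sym[of k "k - 1" \<mu>' \<mu>] by (cases k) auto
  then have "down_rate n \<mu>' \<mu> = 0"
    by (auto simp: down_rate_def intro!: sum.neutral)
  ultimately show ?thesis by simp
qed

text \<open>Adding \<open>up_down_balance\<close> for both orders of the pair covers raising and
  lowering at once.\<close>

lemma part_detailed_balance:
  assumes "\<mu> \<in> partitions n p q" "\<mu>' \<in> partitions n p q"
  shows "weight p q u \<mu> * part_rate n u \<mu> \<mu>' = weight p q u \<mu>' * part_rate n u \<mu>' \<mu>"
  using up_down_balance[OF assms] up_down_balance[OF assms(2,1)]
  by (simp add: part_rate_eq distrib_left)

lemma not_changes_part_self: "i \<noteq> j \<Longrightarrow> \<not> changes_part i j \<mu> \<mu>"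
  by (auto simp: changes_part_iff)

lemma part_rate_self: "part_rate n u \<mu> \<mu> = 0"
  by (auto simp: part_rate_def not_changes_part_self intro!: sum.neutral)

lemma part_rate_nonneg: "0 \<le> u \<Longrightarrow> 0 \<le> part_rate n u \<mu> \<mu>'"
  by (auto simp: part_rate_def intro!: add_nonneg_nonneg sum_nonneg)

section \<open>Words\<close>

lemma binary_wordsD:
  assumes "w \<in> binary_words n q" "q < n"
  shows "length w = n" "set w \<subseteq> {0, 1}" "mset w = mset (column n q)"
proof -
  show m: "mset w = mset (column n q)"
    using assms by (simp add: binary_words_def permutations_of_multiset_def)
  then have "size (mset w) = size (mset (column n q))" by (rule arg_cong)
  then show "length w = n" using assms by (simp add: column_def)
  have "set w = set (column n q)" using m by (rule mset_eq_setD)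
  then show "set w \<subseteq> {0, 1}" by (auto simp: column_def)
qed

lemma Suc_mod_neq: "1 < n \<Longrightarrow> k < n \<Longrightarrow> Suc k mod n \<noteq> k"
  by (cases "Suc k = n") auto

text \<open>For \<open>1 < n\<close> the two cyclic positions are distinct, so the swap undoes
  itself.\<close>

lemma replaces_at_sym:
  assumes "replaces_at n k a b w w'" "length w = n" "1 < n" "k < n"
  shows "replaces_at n k b a w' w"
  using assms Suc_mod_neq[OF assms(3,4)]
  by (auto simp: replaces_at_def list_update_swap)

lemma replaces_at_binary_words:
  assumes "replaces_at n k a b w w'" "w \<in> binary_words n q" "q < n" "k < n"
  shows "w' \<in> binary_words n q"
proof -
  have "mset w' = mset w"
    using mset_swap[of "Suc k mod n" w k] assms(1,4) binary_wordsD(1)[OF assms(2,3)]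
    by (auto simp: replaces_at_def)
  then show ?thesis
    using assms(2) by (simp add: binary_words_def permutations_of_multiset_def)
qed

definition occurrences :: "nat \<Rightarrow> nat \<Rightarrow> nat \<Rightarrow> nat list \<Rightarrow> real" where
  "occurrences n a b w = (\<Sum>k<n. if w ! k = a \<and> w ! (Suc k mod n) = b then 1 else 0)"

text \<open>Each occurrence of \<open>ab\<close> determines exactly one target, which is again a
  binary word; exchanging the sums therefore counts occurrences.\<close>

lemma sum_replaces_from:
  assumes "w \<in> binary_words n q" "q < n"
  shows "(\<Sum>w'\<in>binary_words n q. \<Sum>k<n. if replaces_at n k a b w w' then c else 0) =
    c * occurrences n a b w"
proof -
  have "(\<Sum>w'\<in>binary_words n q. if replaces_at n k a b w w' then c else 0) =
      c * (if w ! k = a \<and> w ! (Suc k mod n) = b then 1 else 0)" if "k < n" for k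
  proof (cases "w ! k = a \<and> w ! (Suc k mod n) = b")
    case True
    define v where "v = w[k := b, Suc k mod n := a]"
    have "replaces_at n k a b w w' \<longleftrightarrow> w' = v" for w'
      using True by (simp add: replaces_at_def v_def)
    moreover from this have "v \<in> binary_words n q"
      using replaces_at_binary_words[OF _ assms that] by blast
    ultimately show ?thesis
      using True by (simp add: finite_binary_words)
  qed (auto simp: replaces_at_def)
  then show ?thesis
    by (subst sum.swap) (simp add: occurrences_def sum_distrib_left)
qed

text \<open>A move into \<open>w\<close> that creates \<open>ba\<close> at position \<open>k\<close>
  is the reversal of a move out of \<open>w\<close> that starts from this \<open>ba\<close>.\<close>

lemma sum_replaces_to:
  assumes "w \<in> binary_words n q" "q < n" "0 < q"
  shows "(\<Sum>w'\<in>binary_words n q. \<Sum>k<n. if replaces_at n k a b w' w then c else 0) =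
    c * occurrences n b a w"
proof -
  have "replaces_at n k a b w' w \<longleftrightarrow> replaces_at n k b a w w'"
    if "w' \<in> binary_words n q" "k < n" for w' k
    using replaces_at_sym[of n k a b w' w] replaces_at_sym[of n k b a w w'] that
      binary_wordsD(1)[OF assms(1,2)] binary_wordsD(1)[OF that(1) assms(2)] assms
    by auto
  then show ?thesis
    unfolding sum_replaces_from[OF assms(1,2), symmetric] by (intro sum.cong refl) simp
qed

lemma sum_cyclic_shift: "(\<Sum>k<n. g (Suc k mod n)) = (\<Sum>k<n. g k :: real)"
proof (cases n)
  case (Suc m)
  have "(\<Sum>k<Suc m. g (Suc k mod Suc m)) = (\<Sum>k<m. g (Suc k mod Suc m)) + g 0"
    by simp
  also have "(\<Sum>k<m. g (Suc k mod Suc m)) = (\<Sum>k<m. g (Suc k))"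
    by (intro sum.cong) auto
  finally show ?thesis unfolding Suc by (simp only: sum.lessThan_Suc_shift add.commute)
qed simp

text \<open>For binary letters, the indicator of \<open>01\<close> minus that of \<open>10\<close>
  is the second letter minus the first, and these differences cancel around the cycle.\<close>

lemma occurrences_01_10:
  assumes "set w \<subseteq> {0, 1}" "length w = n"
  shows "occurrences n 0 1 w = occurrences n 1 0 w"
proof -
  have "occurrences n 0 1 w - occurrences n 1 0 w =
      (\<Sum>k<n. real (w ! (Suc k mod n)) - real (w ! k))"
    unfolding occurrences_def sum_subtractf[symmetric]
  proof (intro sum.cong refl)
    fix k assume "k \<in> {..<n}"
    then have "k < n" "Suc k mod n < n" by auto
    then have "w ! k \<in> {0, 1}" "w ! (Suc k mod n) \<in> {0, 1}"
      using assms nth_mem[of k w] nth_mem[of "Suc k mod n" w] by (metis subsetD)+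
    then show "(if w ! k = 0 \<and> w ! (Suc k mod n) = 1 then 1 else 0) -
        (if w ! k = 1 \<and> w ! (Suc k mod n) = 0 then 1 else 0) =
        real (w ! (Suc k mod n)) - real (w ! k)"
      by auto
  qed
  also have "\<dots> = 0"
    by (simp add: sum_subtractf sum_cyclic_shift[where g = "\<lambda>k. real (w ! k)"])
  finally show ?thesis by simp
qed

text \<open>Both totals have the form of one count plus \<open>t\<close> times the other, over
  \<open>3n\<close>, with the factors 01 and 10 exchanged; the two counts coincide.\<close>

lemma word_balance:
  assumes "w \<in> binary_words n q" "q < n" "0 < q"
  shows "(\<Sum>w'\<in>binary_words n q. word_rate n t w' w) = (\<Sum>w'\<in>binary_words n q. word_rate n t w w')"
  using occurrences_01_10[OF binary_wordsD(2,1)[OF assms(1,2)]]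
  by (simp add: word_rate_def sum.distrib sum_replaces_from[OF assms(1,2)] sum_replaces_to[OF assms])

lemma word_rate_self:
  assumes "length w = n" "1 < n"
  shows "word_rate n t w w = 0"
proof -
  have "\<not> replaces_at n k a b w w" if "k < n" "a \<noteq> b" for k a b
  proof
    assume r: "replaces_at n k a b w w"
    then have "w ! k = w[k := b, Suc k mod n := a] ! k" by (simp add: replaces_at_def)
    also have "\<dots> = b" using that assms Suc_mod_neq[of n k] by simp
    finally show False using r that by (simp add: replaces_at_def)
  qed
  then show ?thesis by (simp add: word_rate_def)
qed

lemma word_rate_nonneg: "0 \<le> t \<Longrightarrow> 0 \<le> word_rate n t w w'"
  by (auto simp: word_rate_def intro!: add_nonneg_nonneg sum_nonneg)

section \<open>The colored Boolean process\<close>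

text \<open>Both rates vanish on the diagonal, so the case distinction becomes a sum and sums over
  the product state space separate.\<close>

lemma cbp_rate_split:
  assumes "w \<in> binary_words n q" "q < n" "0 < q"
  shows "cbp_rate n t u (w, \<mu>) (w', \<mu>') =
    (if w' = w then part_rate n u \<mu> \<mu>' else 0) + (if \<mu>' = \<mu> then word_rate n t w w' else 0)"
  using binary_wordsD(1)[OF assms(1,2)] assms
  by (auto simp: cbp_rate_def part_rate_self word_rate_self)

lemma cbp_rate_nonneg: "0 \<le> t \<Longrightarrow> 0 \<le> u \<Longrightarrow> 0 \<le> cbp_rate n t u x y"
  by (simp add: cbp_rate_def part_rate_nonneg word_rate_nonneg)

lemma finite_partitions:
  assumes "q \<le> n"
  shows "finite (partitions n p q)"
proof -
  have "column n q \<in> binary_words n q"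
    by (simp add: binary_words_def permutations_of_multiset_def)
  then have "partitions n p q = snd ` cbp_states n p q"
    by (force simp: cbp_states_eq)
  then show ?thesis by (simp add: finite_cbp_states)
qed

lemma balanced_weight:
  assumes "q < n" "0 < q"
  shows "balanced (cbp_states n p q) (cbp_rate n t u) (\<lambda>x. weight p q u (snd x))"
  unfolding balanced_def
proof
  let ?B = "binary_words n q" and ?L = "partitions n p q" and ?f = "weight p q u"
  fix y assume "y \<in> cbp_states n p q"
  then obtain w \<mu> where y: "y = (w, \<mu>)" and w: "w \<in> ?B" and \<mu>: "\<mu> \<in> ?L"
    by (auto simp: cbp_states_eq)
  note fin = finite_binary_words[of n q] finite_partitions[OF less_imp_le[OF assms(1)], of p]
  have "(\<Sum>x\<in>cbp_states n p q. ?f (snd x) * cbp_rate n t u x y) =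
      (\<Sum>w'\<in>?B. \<Sum>\<mu>'\<in>?L. (if w = w' then ?f \<mu>' * part_rate n u \<mu>' \<mu> else 0) +
        (if \<mu> = \<mu>' then ?f \<mu> * word_rate n t w' w else 0))"
    unfolding cbp_states_eq sum.cartesian_product y
    by (intro sum.cong) (auto simp: cbp_rate_split[OF _ assms] distrib_left)
  \<comment> \<open>Each indicator collapses one of the two sums; one summand first needs the order
    of summation exchanged.\<close>
  also have "\<dots> = (\<Sum>\<mu>'\<in>?L. ?f \<mu>' * part_rate n u \<mu>' \<mu>) + (\<Sum>w'\<in>?B. ?f \<mu> * word_rate n t w' w)"
    using w \<mu> fin by (simp add: sum.distrib) (subst sum.swap, simp)
  \<comment> \<open>Partition moves are reversed term by term by detailed balance. Word moves are
    balanced only after summation, which suffices since the weight ignores the word.\<close>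
  also have "\<dots> = ?f \<mu> * ((\<Sum>\<mu>'\<in>?L. part_rate n u \<mu> \<mu>') + (\<Sum>w'\<in>?B. word_rate n t w w'))"
    using part_detailed_balance[OF _ \<mu>, of _ u] word_balance[OF w assms, of t]
    by (simp add: distrib_left sum_distrib_left[symmetric])
  also have "(\<Sum>\<mu>'\<in>?L. part_rate n u \<mu> \<mu>') + (\<Sum>w'\<in>?B. word_rate n t w w') =
      (\<Sum>w'\<in>?B. \<Sum>\<mu>'\<in>?L. (if w' = w then part_rate n u \<mu> \<mu>' else 0) +
        (if \<mu>' = \<mu> then word_rate n t w w' else 0))"
    using w \<mu> fin by (simp add: sum.distrib) (subst sum.swap, simp)
  also have "\<dots> = (\<Sum>z\<in>cbp_states n p q. cbp_rate n t u y z)"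
    unfolding cbp_states_eq sum.cartesian_product y
    by (intro sum.cong) (auto simp: cbp_rate_split[OF w assms])
  finally show "(\<Sum>x\<in>cbp_states n p q. ?f (snd x) * cbp_rate n t u x y) =
      ?f (snd y) * (\<Sum>z\<in>cbp_states n p q. cbp_rate n t u y z)"
    by (simp add: y)
qed

text \<open>The diagonal of \<open>cbp_prob\<close> is 1 minus the total rate out, so the
  fixed-vector equation says that inflow equals outflow.\<close>

lemma stationary_balanced:
  assumes "stationary (cbp_states n p q) (cbp_prob n p q t u) \<pi>" "q < n" "0 < q"
  shows "balanced (cbp_states n p q) (cbp_rate n t u) \<pi>"
  unfolding balanced_def
proof
  let ?S = "cbp_states n p q" and ?R = "cbp_rate n t u"
  fix y assume y: "y \<in> ?S"
  have "?R y y = 0"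
    using y cbp_rate_split[OF _ assms(2,3), of "fst y" t u "snd y" "fst y" "snd y"]
      binary_wordsD(1)[OF _ assms(2), of "fst y"] assms(2,3)
    by (auto simp: cbp_states_eq part_rate_self word_rate_self)
  then have out: "(\<Sum>z\<in>?S - {y}. ?R y z) = (\<Sum>z\<in>?S. ?R y z)"
    and into: "(\<Sum>x\<in>?S - {y}. \<pi> x * ?R x y) = (\<Sum>x\<in>?S. \<pi> x * ?R x y)"
    using y finite_cbp_states[of n p q] by (simp_all add: sum.remove)
  have "\<pi> y = (\<Sum>x\<in>?S. \<pi> x * cbp_prob n p q t u x y)"
    using assms(1) y by (simp add: stationary_def)
  also have "\<dots> = \<pi> y * cbp_prob n p q t u y y + (\<Sum>x\<in>?S - {y}. \<pi> x * cbp_prob n p q t u x y)"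
    using y finite_cbp_states by (intro sum.remove)
  also have "(\<Sum>x\<in>?S - {y}. \<pi> x * cbp_prob n p q t u x y) = (\<Sum>x\<in>?S - {y}. \<pi> x * ?R x y)"
    by (intro sum.cong) (auto simp: cbp_prob_def)
  finally show "(\<Sum>x\<in>?S. \<pi> x * ?R x y) = \<pi> y * (\<Sum>z\<in>?S. ?R y z)"
    by (simp add: cbp_prob_def out into algebra_simps)
qed

section \<open>Paths to the column state\<close>

lemma lower_part:
  assumes \<mu>: "\<mu> \<in> partitions n p q" and "\<mu> \<noteq> column n q"
  obtains i \<mu>' where "2 \<le> i" "\<mu>' \<in> partitions n p q" "changes_part i (i - 1) \<mu> \<mu>'"
proof -
  have \<mu>': "sorted_wrt (\<ge>) \<mu>" "length \<mu> = n" "num_parts \<mu> = q"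
    using \<mu> by (auto simp: partitions_def is_partition_def)
  \<comment> \<open>With all parts at most 1, length and number of positive parts would determine
    the partition, making it the column. So some part is at least 2, and it stays positive when
    lowered.\<close>
  have "\<not> set \<mu> \<subseteq> {0, 1}"
    using sorted_desc_unique[OF \<mu>'(1) sorted_column] mset_le_1[of \<mu>] \<mu>' assms(2) by auto
  then obtain i where i: "i \<in> set \<mu>" "i \<noteq> 0" "i \<noteq> 1" by auto
  then obtain M where M: "mset \<mu> = add_mset i M"
    using multi_member_split[of i "mset \<mu>"] by auto
  define \<nu> where "\<nu> = rev (sorted_list_of_multiset (add_mset (i - 1) M))"
  have \<nu>: "mset \<nu> = add_mset (i - 1) M" by (simp add: \<nu>_def)
  have "size (mset \<nu>) = size (mset \<mu>)"
    by (simp only: M \<nu> size_add_mset)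
  then have "length \<nu> = n" using \<mu>' by simp
  moreover have "sorted_wrt (\<ge>) \<nu>"
    using sorted_sorted_list_of_multiset[of "add_mset (i - 1) M"]
    unfolding \<nu>_def by (simp only: sorted_wrt_rev)
  moreover have "num_parts \<nu> = num_parts \<mu>"
    using i by (simp add: num_parts_mset M \<nu>)
  moreover have "hd \<nu> \<le> p"
  proof -
    have "\<nu> \<noteq> []" using \<nu> by auto
    then have "hd \<nu> \<in># add_mset (i - 1) M"
      by (metis \<nu> hd_in_set set_mset_mset)
    then have "hd \<nu> = i - 1 \<or> hd \<nu> \<in> set \<mu>"
      by (metis M insert_iff set_mset_add_mset_insert set_mset_mset)
    then show ?thesis using partition_le[OF \<mu>, of i] partition_le[OF \<mu>, of "hd \<nu>"] i by auto
  qed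
  ultimately have "\<nu> \<in> partitions n p q"
    using \<mu>' by (simp add: partitions_def is_partition_def)
  moreover have "changes_part i (i - 1) \<mu> \<nu>"
    using M \<nu> by (auto simp: changes_part_iff)
  ultimately show ?thesis using that[of i \<nu>] i by linarith
qed

text \<open>Lowering carries no factor \<open>u\<close>, hence the strict inequality even at
  \<open>u = 0\<close>.\<close>

lemma part_rate_lower_pos:
  assumes "changes_part i (i - 1) \<mu> \<mu>'" "1 \<le> i" "0 < n" "0 \<le> u"
  shows "0 < part_rate n u \<mu> \<mu>'"
proof -
  have "i \<in> set \<mu>" using assms by (simp add: changes_part_def)
  then have "0 < count_list \<mu> i" using count_list_0_iff[of \<mu> i] by simp
  then have "0 < down_rate n \<mu> \<mu>'"
    unfolding down_rate_def using assms \<open>i \<in> set \<mu>\<close> by (intro sum_pos2[of _ i]) auto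
  moreover have "0 \<le> up_rate n u \<mu> \<mu>'"
    using assms by (auto simp: up_rate_def intro!: sum_nonneg)
  ultimately show ?thesis by (simp add: part_rate_eq)
qed

lemma word_rate_pos:
  assumes "replaces_at n k 0 1 w w'" "k < n" "0 \<le> t"
  shows "0 < word_rate n t w w'"
proof -
  have "0 < (\<Sum>k<n. if replaces_at n k 0 1 w w' then 1 / (3 * real n) else 0)"
    using assms by (intro sum_pos2[of _ k]) auto
  moreover have "0 \<le> (\<Sum>k<n. if replaces_at n k 1 0 w w' then t / (3 * real n) else 0)"
    using assms by (intro sum_nonneg) auto
  ultimately show ?thesis by (simp add: word_rate_def)
qed

text \<open>By transitivity a failure of weak decrease shows at neighbouring positions, and in a
  binary word it must be 01. This occurrence does not wrap around.\<close>

lemma unsorted_word_descent: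
  assumes "set w \<subseteq> {0, 1 :: nat}" "\<not> sorted_wrt (\<ge>) w"
  obtains k where "Suc k < length w" "w ! k = 0" "w ! Suc k = 1"
proof -
  have "\<exists>k. Suc k < length w \<and> \<not> w ! k \<ge> w ! Suc k"
  proof (rule ccontr)
    assume "\<not> ?thesis"
    then have "\<forall>k. Suc k < length w \<longrightarrow> w ! k \<ge> w ! Suc k" by blast
    then have "sorted_wrt (\<ge>) w"
      by (intro sorted_wrt_iff_nth_Suc_transp[THEN iffD2]) (auto simp: transp_def)
    with assms show False by simp
  qed
  then obtain k where k: "Suc k < length w" "w ! k < w ! Suc k" by auto
  moreover have "w ! k \<in> {0, 1}" "w ! Suc k \<in> {0, 1}"
    using assms(1) k(1) nth_mem[of k w] nth_mem[of "Suc k" w] by (metis Suc_lessD subsetD)+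
  ultimately show ?thesis using that[of k] by auto
qed

abbreviation cbp_steps :: "nat \<Rightarrow> nat \<Rightarrow> nat \<Rightarrow> real \<Rightarrow> real \<Rightarrow>
    ((nat list \<times> nat list) \<times> (nat list \<times> nat list)) set" where
  "cbp_steps n p q t u \<equiv>
     {(x, y). x \<in> cbp_states n p q \<and> y \<in> cbp_states n p q \<and> 0 < cbp_rate n t u x y}"

text \<open>Each lowering reduces the size of the partition by one, so induction on
  \<open>sum_list \<mu>\<close> ends at the column.\<close>

lemma reach_column_partition:
  assumes "w \<in> binary_words n q" "\<mu> \<in> partitions n p q" "q < n" "0 < q" "0 \<le> u"
  shows "((w, \<mu>), (w, column n q)) \<in> (cbp_steps n p q t u)\<^sup>*"
  using assms(2)
proof (induction "sum_list \<mu>" arbitrary: \<mu> rule: less_induct)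
  case less
  show ?case
  proof (cases "\<mu> = column n q")
    case False
    then obtain i \<mu>' where i: "2 \<le> i" "\<mu>' \<in> partitions n p q" "changes_part i (i - 1) \<mu> \<mu>'"
      using lower_part less.prems by blast
    then obtain M where "mset \<mu> = add_mset i M" "mset \<mu>' = add_mset (i - 1) M"
      by (auto simp: changes_part_iff)
    then have "sum_mset (mset \<mu>') < sum_mset (mset \<mu>)"
      using i(1) by simp
    then have "((w, \<mu>'), (w, column n q)) \<in> (cbp_steps n p q t u)\<^sup>*"
      using less.hyps i by (simp add: sum_mset_sum_list)
    moreover have "((w, \<mu>), (w, \<mu>')) \<in> cbp_steps n p q t u"
      using less.prems i assms part_rate_lower_pos[OF i(3)]
      by (simp add: cbp_states_eq cbp_rate_def)
    ultimately show ?thesis by (rule converse_rtrancl_into_rtrancl[rotated])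
  qed simp
qed

text \<open>In a binary word this is the sum of the positions of the ones; the swap moves a one from
  \<open>Suc k\<close> to \<open>k\<close>. It serves as termination measure for sorting.\<close>

lemma sum_index_swap_less:
  assumes "Suc k < length w" "w ! k = 0" "w ! Suc k = (1 :: nat)"
  shows "(\<Sum>i<length w. i * w[k := 1, Suc k := 0] ! i) < (\<Sum>i<length w. i * w ! i)"
proof -
  let ?I = "{..<length w} - {k} - {Suc k}"
  have split: "(\<Sum>i<length w. i * v ! i) = k * v ! k + (Suc k * v ! Suc k + (\<Sum>i\<in>?I. i * v ! i))"
    for v :: "nat list"
    using assms(1)
    by (subst sum.remove[of _ k], simp, simp, subst sum.remove[of _ "Suc k"], simp_all)
  have "(\<Sum>i\<in>?I. i * w[k := 1, Suc k := 0] ! i) = (\<Sum>i\<in>?I. i * w ! i)"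
    by (intro sum.cong) auto
  then show ?thesis unfolding split using assms by simp
qed

lemma reach_column_word:
  assumes "w \<in> binary_words n q" "\<mu> \<in> partitions n p q" "q < n" "0 < q" "0 \<le> t"
  shows "((w, \<mu>), (column n q, \<mu>)) \<in> (cbp_steps n p q t u)\<^sup>*"
  using assms(1)
proof (induction "\<Sum>i<n. i * w ! i" arbitrary: w rule: less_induct)
  case less
  note w = binary_wordsD[OF less.prems assms(3)]
  show ?case
  proof (cases "sorted_wrt (\<ge>) w")
    case True
    then have "w = column n q" using sorted_desc_unique sorted_column w(3) by blast
    then show ?thesis by simp
  next
    case False
    then obtain k where k: "Suc k < n" "w ! k = 0" "w ! Suc k = 1"
      using unsorted_word_descent[OF w(2)] w(1) by metis
    define v where "v = w[k := 1, Suc k := 0]"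
    have r: "replaces_at n k 0 1 w v"
      using k by (simp add: replaces_at_def v_def)
    have v: "v \<in> binary_words n q"
      using replaces_at_binary_words[OF r less.prems assms(3)] k by simp
    have "(\<Sum>i<n. i * v ! i) < (\<Sum>i<n. i * w ! i)"
      using sum_index_swap_less[of k w] k w(1) by (simp add: v_def)
    then have "((v, \<mu>), (column n q, \<mu>)) \<in> (cbp_steps n p q t u)\<^sup>*"
      using less.hyps v by blast
    \<comment> \<open>The words must be seen to differ, since \<open>cbp_rate\<close> uses
      \<open>word_rate\<close> only for distinct first coordinates.\<close>
    moreover have "v ! k = 1" using k w(1) by (simp add: v_def)
    then have "v \<noteq> w" using k by auto
    then have "((w, \<mu>), (v, \<mu>)) \<in> cbp_steps n p q t u"
      using less.prems v assms word_rate_pos[OF r] k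
      by (auto simp: cbp_states_eq cbp_rate_def)
    ultimately show ?thesis by (rule converse_rtrancl_into_rtrancl[rotated])
  qed
qed

theorem theorem2p6:
  fixes n p q :: nat and t u :: real and \<pi> :: "nat list \<times> nat list \<Rightarrow> real"
  assumes "0 < n" and "0 < p" and "0 < q" and "q < n"
    and "0 \<le> t" and "t \<le> 1" and "0 \<le> u" and "u \<le> 1"
    and "stationary (cbp_states n p q) (cbp_prob n p q t u) \<pi>"
  shows "(\<forall>w\<in>binary_words n q. \<forall>w'\<in>binary_words n q. \<pi> (w, column n q) = \<pi> (w', column n q)) \<and>
    (\<forall>(w, \<mu>)\<in>cbp_states n p q.
       \<pi> (w, \<mu>) = u ^ (sum_list \<mu> - q) * multinomial q (map (count_list \<mu>) [1..<p + 1]) *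
         \<pi> (w, column n q))"
proof -
  let ?c = "column n q"
  have c: "?c \<in> partitions n p q"
    using assms by (intro column_in_partitions)
  \<comment> \<open>The weight of the column is 1, so the factor \<open>\<pi> (?c, ?c)\<close> makes
    \<open>d\<close> vanish at \<open>(?c, ?c)\<close>.\<close>
  define d where "d = (\<lambda>x. \<pi> x - \<pi> (?c, ?c) * weight p q u (snd x))"
  have bal: "balanced (cbp_states n p q) (cbp_rate n t u) d"
    unfolding d_def using assms
    by (intro balanced_diff_scale stationary_balanced balanced_weight) auto
  have d0: "d (?c, ?c) = 0"
    using assms(2) by (simp add: d_def weight_column)
  have eq: "\<pi> (w, \<mu>) = \<pi> (?c, ?c) * weight p q u \<mu>"
    if "w \<in> binary_words n q" "\<mu> \<in> partitions n p q" for w \<mu>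
  proof -
    \<comment> \<open>First all parts are lowered with the word fixed, then the word is
      sorted.\<close>
    have "((w, \<mu>), (?c, ?c)) \<in> (cbp_steps n p q t u)\<^sup>*"
      using reach_column_partition[OF that] reach_column_word[OF that(1) c] assms
      by (meson rtrancl_trans)
    then have "d (w, \<mu>) = 0"
      using balanced_eq_0[OF finite_cbp_states _ bal d0] cbp_rate_nonneg assms by blast
    then show ?thesis by (simp add: d_def)
  qed
  \<comment> \<open>At the column partition \<open>eq\<close> gives the same value
    \<open>\<pi> (?c, ?c)\<close> for every word. This is the first claim, and it turns
    \<open>eq\<close> into the second.\<close>
  show ?thesis
    unfolding weight_def[symmetric]
    using eq c assms(2) by (auto simp: cbp_states_eq weight_column)
qed

end
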